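(* Let $m$ be a positive integer, $c$ be a positive real number and $\alpha\in\mathbb{C}$. For $k\in\{0,1\}$, let $$f_k(z)=z+\overline{\alpha z^k\sum_{n=0}^m\binom{m}{n}\frac{(m-n+1,n)}{(c,n)}\frac{z^{n+1}}{n+1}}.$$ (a) If $0<|\alpha|<1$ and $$\frac{\Gamma(c)\Gamma(c+2m)}{(\Gamma(c+m))^2}\le\frac{1}{|\alpha|},$$ then $f_0\in\mathcal{C}_H^1$. (b) If $0<|\alpha|<1/2$ and $$|\alpha|\frac{\Gamma(c)\Gamma(c+2m)}{(\Gamma(c+m))^2}\left(1+\frac{c+2m}{(m+1)^2}\right)\le 1+|\alpha|\frac{(c-1)}{(m+1)^2},$$ then $f_1\in\mathcal{C}_H^1\cap\mathcal{S}_H^{*0}$.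
   Context: $\mathbb{D}=\{z\in\mathbb{C}:|z|<1\}$. $(x,0)=1$ and $(x,n)=x(x+1)\cdots(x+n-1)$ for positive integers $n$ (Pochhammer symbol). $\mathcal{H}$ is the class of complex-valued harmonic functions $f=h+\overline{g}$ in $\mathbb{D}$ with $h(z)=z+\sum_{n=2}^\infty a_nz^n$ and $g(z)=\sum_{n=1}^\infty b_nz^n$ analytic in $\mathbb{D}$. $\mathcal{S}_H$ is the class of $f\in\mathcal{H}$ that are univalent and sense-preserving (i.e. $|h'|^2-|g'|^2>0$) in $\mathbb{D}$. $\mathcal{C}_H^1=\{f\in\mathcal{S}_H:\ \mathrm{Re}\,f_z(z)>|f_{\overline z}(z)|\text{ for all } z\in\mathbb{D}\}$, where $f_z=h'$ and $f_{\overline z}=\overline{g'}$. $\mathcal{S}_H^{*0}$ is the class of $f\in\mathcal{S}_H$ with $f_{\overline z}(0)=0$ such that $f(\mathbb{D})$ is a starlike domain with respect to the origin. *)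

theory Defs
  imports "HOL-Complex_Analysis.Complex_Analysis"
begin

abbreviation unit_disc :: "complex set" ("\<D>") where
  "\<D> \<equiv> ball 0 1"

text \<open>
  Harmonic functions on the disc are represented by total functions; every notion below
  depends only on the values of the function on \<open>\<D>\<close>.
\<close>

definition harmonic_rep ::
  "(complex \<Rightarrow> complex) \<Rightarrow> (complex \<Rightarrow> complex) \<Rightarrow> (complex \<Rightarrow> complex) \<Rightarrow> bool" where
  "harmonic_rep f h g \<longleftrightarrow>
     h holomorphic_on \<D> \<and> g holomorphic_on \<D> \<and>
     (\<exists>a. \<forall>z\<in>\<D>. (\<lambda>n. a (n + 2) * z ^ (n + 2)) sums (h z - z)) \<and>
     (\<exists>b. \<forall>z\<in>\<D>. (\<lambda>n. b (n + 1) * z ^ (n + 1)) sums g z) \<and>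
     (\<forall>z\<in>\<D>. f z = h z + cnj (g z))"

definition class_H :: "(complex \<Rightarrow> complex) set" where
  "class_H = {f. \<exists>h g. harmonic_rep f h g}"

definition class_SH :: "(complex \<Rightarrow> complex) set" where
  "class_SH = {f. inj_on f \<D> \<and>
     (\<exists>h g. harmonic_rep f h g \<and>
        (\<forall>z\<in>\<D>. (cmod (deriv h z))\<^sup>2 - (cmod (deriv g z))\<^sup>2 > 0))}"

text \<open>
  The Wirtinger derivatives \<open>(f\<^sub>x - \<i> f\<^sub>y) / 2\<close> and \<open>(f\<^sub>x + \<i> f\<^sub>y) / 2\<close>.
\<close>

definition wirtinger_z :: "(complex \<Rightarrow> complex) \<Rightarrow> complex \<Rightarrow> complex" where
  "wirtinger_z f z =
     (frechet_derivative f (at z) 1 - \<i> * frechet_derivative f (at z) \<i>) / 2"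

definition wirtinger_zbar :: "(complex \<Rightarrow> complex) \<Rightarrow> complex \<Rightarrow> complex" where
  "wirtinger_zbar f z =
     (frechet_derivative f (at z) 1 + \<i> * frechet_derivative f (at z) \<i>) / 2"

lemma wirtinger_harmonic_rep:
  assumes rep: "harmonic_rep f h g" and z: "z \<in> \<D>"
  shows "wirtinger_z f z = deriv h z" "wirtinger_zbar f z = cnj (deriv g z)"
proof -
  have h: "(h has_field_derivative deriv h z) (at z)"
    and g: "(g has_field_derivative deriv g z) (at z)"
    using rep z unfolding harmonic_rep_def by (auto intro: holomorphic_derivI)
  have "((\<lambda>w. h w + cnj (g w)) has_derivative (\<lambda>v. deriv h z * v + cnj (deriv g z * v))) (at z)"
    using h g unfolding has_field_derivative_def
    by (intro has_derivative_add has_derivative_cnj)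
  then have "(f has_derivative (\<lambda>v. deriv h z * v + cnj (deriv g z * v))) (at z)"
  proof (rule has_derivative_transform_within_open)
    show "open \<D>" by simp
    show "z \<in> \<D>" by fact
    show "h w + cnj (g w) = f w" if "w \<in> \<D>" for w
      using rep that unfolding harmonic_rep_def by simp
  qed
  then have fd: "frechet_derivative f (at z) = (\<lambda>v. deriv h z * v + cnj (deriv g z * v))"
    by (metis frechet_derivative_at)
  show "wirtinger_z f z = deriv h z" "wirtinger_zbar f z = cnj (deriv g z)"
    unfolding wirtinger_z_def wirtinger_zbar_def fd by (simp_all add: algebra_simps)
qed

definition class_CH1 :: "(complex \<Rightarrow> complex) set" where
  "class_CH1 = {f \<in> class_SH. \<forall>z\<in>\<D>. Re (wirtinger_z f z) > cmod (wirtinger_zbar f z)}"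

definition starlike_domain :: "complex \<Rightarrow> complex set \<Rightarrow> bool" where
  "starlike_domain a S \<longleftrightarrow>
     open S \<and> connected S \<and> a \<in> S \<and> (\<forall>w\<in>S. closed_segment a w \<subseteq> S)"

definition class_SH_star0 :: "(complex \<Rightarrow> complex) set" where
  "class_SH_star0 = {f \<in> class_SH. wirtinger_zbar f 0 = 0 \<and> starlike_domain 0 (f ` \<D>)}"

definition hyp_map :: "nat \<Rightarrow> real \<Rightarrow> complex \<Rightarrow> nat \<Rightarrow> complex \<Rightarrow> complex" where
  "hyp_map m c \<alpha> k z =
     z + cnj (\<alpha> * z ^ k *
       (\<Sum>n=0..m. of_real (real (m choose n) *
            (pochhammer (real m - real n + 1) n / pochhammer c n)) *
          (z ^ (n + 1) / of_nat (n + 1))))"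

end

theory Submission
  imports Defs
begin

text \<open>
  The map is \<open>f(z) = z + cnj (\<Sum>j. b\<^sub>j z ^ (j + 1))\<close>, and both hypotheses say that
  \<open>\<Sum>j. (j + 1) \<bar>b\<^sub>j\<bar> \<le> 1\<close>: the coefficient sums are evaluated by the Chu-Vandermonde identity.
  Hence the co-analytic part \<open>g\<close> has \<open>\<bar>g'\<bar> < 1\<close>, which makes \<open>f\<close> injective with \<open>Re h' = 1 > \<bar>g'\<bar>\<close>.
  The same bound gives \<open>Re ((z h' - cnj (z g')) / f) > 0\<close> off the origin, so that pulling a ray
  back along \<open>f\<close> yields a curve of increasing modulus; therefore the image is starlike.
\<close>

section \<open>Two hypergeometric sums\<close>

text \<open>Chu-Vandermonde with parameters \<open>- m\<close> and \<open>1 - c - m\<close>. Each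
  rising factorial of a negated argument reflects to a positive one; the signs
  \<open>(-1) ^ n\<close> and \<open>(-1) ^ (m - n)\<close> combine to \<open>(-1) ^ m\<close>,
  which leaves the sum and cancels when the right-hand side is reflected back.\<close>

lemma pochhammer_binomial_sum_reflected:
  fixes c :: real
  shows "(\<Sum>n\<le>m. real (m choose n) * pochhammer (real m - real n + 1) n *
           pochhammer (c + real n) (m - n)) = pochhammer (c + real m) m"
proof -
  have "real (m choose n) * pochhammer (real m - real n + 1) n * pochhammer (c + real n) (m - n)
      = (-1) ^ m * (real (m choose n) * pochhammer (- real m) n *
          pochhammer (1 - c - real m) (m - n))" if "n \<le> m" for n
  proof -
    have 1: "pochhammer (- real m) n = (-1) ^ n * pochhammer (real m - real n + 1) n"
      by (simp add: pochhammer_minus)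
    have "1 - c - real m = - (c + real m - 1)"
      by simp
    then have 2: "pochhammer (1 - c - real m) (m - n) = (-1) ^ (m - n) * pochhammer (c + real n) (m - n)"
      using that by (simp only: pochhammer_minus) (simp add: of_nat_diff)
    have 3: "(-1 :: real) ^ m * ((-1) ^ n * (-1) ^ (m - n)) = 1"
      using that by (simp flip: power_add)
    have "real (m choose n) * pochhammer (real m - real n + 1) n * pochhammer (c + real n) (m - n)
        = ((-1) ^ m * ((-1) ^ n * (-1) ^ (m - n))) *
           (real (m choose n) * pochhammer (real m - real n + 1) n * pochhammer (c + real n) (m - n))"
      unfolding 3 by simp
    then show ?thesis
      unfolding 1 2 by (simp only: mult_ac)
  qed
  then have "(\<Sum>n\<le>m. real (m choose n) * pochhammer (real m - real n + 1) n *
           pochhammer (c + real n) (m - n))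
      = (-1) ^ m * (\<Sum>n\<le>m. real (m choose n) * pochhammer (- real m) n *
          pochhammer (1 - c - real m) (m - n))"
    unfolding sum_distrib_left by (intro sum.cong) auto
  also have "\<dots> = (-1) ^ m * pochhammer (- (c + 2 * real m - 1)) m"
    by (subst pochhammer_binomial_sum [symmetric]) (simp add: algebra_simps)
  also have "\<dots> = pochhammer (c + real m) m"
    by (subst pochhammer_minus) (simp add: algebra_simps flip: power_mult_distrib mult.assoc)
  finally show ?thesis .
qed

text \<open>The coefficient of \<open>z ^ n\<close> in the hypergeometric polynomial \<open>F(-m, -m; c; z)\<close>.\<close>

definition hyp_coeff :: "nat \<Rightarrow> real \<Rightarrow> nat \<Rightarrow> real" where
  "hyp_coeff m c n = real (m choose n) * (pochhammer (real m - real n + 1) n / pochhammer c n)"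

lemma hyp_coeff_nonneg:
  assumes "c > 0" "n \<le> m"
  shows "hyp_coeff m c n \<ge> 0"
  using assms unfolding hyp_coeff_def
  by (intro mult_nonneg_nonneg divide_nonneg_pos pochhammer_nonneg pochhammer_pos) auto

text \<open>Splitting \<open>pochhammer c m\<close> after \<open>n\<close> factors cancels the
  denominator and leaves exactly the summand of the reflected Chu-Vandermonde identity.\<close>

lemma pochhammer_mult_hyp_coeff:
  assumes "c > 0" "n \<le> m"
  shows "pochhammer c m * hyp_coeff m c n =
    real (m choose n) * pochhammer (real m - real n + 1) n * pochhammer (c + real n) (m - n)"
  using assms pochhammer_pos [of c n] unfolding hyp_coeff_def
  by (subst pochhammer_product [of n m]) auto

lemma pochhammer_ratio_Gamma:
  fixes c :: real
  assumes "c > 0"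
  shows "pochhammer (c + real m) m / pochhammer c m =
    Gamma c * Gamma (c + 2 * real m) / (Gamma (c + real m))\<^sup>2"
proof -
  have "c \<notin> \<int>\<^sub>\<le>\<^sub>0" "c + real m \<notin> \<int>\<^sub>\<le>\<^sub>0"
    using assms by (auto elim!: nonpos_Ints_cases)
  then show ?thesis
    by (simp add: pochhammer_Gamma power2_eq_square add.assoc field_simps)
qed

lemma sum_hyp_coeff:
  assumes "c > 0"
  shows "(\<Sum>n\<le>m. hyp_coeff m c n) = Gamma c * Gamma (c + 2 * real m) / (Gamma (c + real m))\<^sup>2"
proof -
  have "pochhammer c m * (\<Sum>n\<le>m. hyp_coeff m c n) = pochhammer (c + real m) m"
    unfolding sum_distrib_left pochhammer_binomial_sum_reflected [symmetric]
    using assms by (intro sum.cong) (auto simp: pochhammer_mult_hyp_coeff)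
  then show ?thesis
    unfolding pochhammer_ratio_Gamma [OF assms, symmetric]
    using pochhammer_pos [OF assms, of m] by (simp add: field_simps)
qed

text \<open>Raising \<open>m\<close> and lowering \<open>c\<close> by one turns the coefficients \<open>hyp_coeff m c n / (n + 1)\<close>
  into hypergeometric ones; the identity is kept free of denominators because \<open>c - 1\<close> may vanish.\<close>

lemma sum_hyp_coeff_divide:
  assumes "c > 0"
  shows "(real m + 1)\<^sup>2 * (\<Sum>n\<le>m. hyp_coeff m c n / (real n + 1)) =
    (c + 2 * real m) * (Gamma c * Gamma (c + 2 * real m) / (Gamma (c + real m))\<^sup>2) - (c - 1)"
proof -
  \<comment> \<open>One factor \<open>m + 1\<close> comes from absorption in the binomial
    coefficient, which also gives the divisor \<open>n + 1\<close>; the other is the last factor of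
    the longer rising factorial.\<close>
  have shift: "real (Suc m choose Suc n) * pochhammer (real (Suc m) - real (Suc n) + 1) (Suc n) *
      pochhammer (c - 1 + real (Suc n)) (Suc m - Suc n)
    = (real m + 1)\<^sup>2 * (pochhammer c m * hyp_coeff m c n / (real n + 1))" if "n \<le> m" for n
  proof -
    have "real (Suc n) * real (Suc m choose Suc n) = real (Suc m) * real (m choose n)"
      by (metis Suc_times_binomial of_nat_mult)
    then have "real (Suc m choose Suc n) = (real m + 1) * real (m choose n) / (real n + 1)"
      by (simp add: field_simps)
    moreover have "pochhammer (real (Suc m) - real (Suc n) + 1) (Suc n) =
        (real m + 1) * pochhammer (real m - real n + 1) n"
      by (simp add: pochhammer_rec' algebra_simps)
    moreover have "pochhammer (c - 1 + real (Suc n)) (Suc m - Suc n) = pochhammer (c + real n) (m - n)"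
      by simp
    ultimately show ?thesis
      unfolding pochhammer_mult_hyp_coeff [OF assms that] by (simp add: power2_eq_square)
  qed
  \<comment> \<open>The index 0 term of the raised sum has no counterpart among the shifted ones;
    split off, it produces the correction \<open>c - 1\<close>.\<close>
  have "pochhammer (c - 1 + real (Suc m)) (Suc m) = pochhammer (c - 1) (Suc m) +
      (\<Sum>n\<le>m. real (Suc m choose Suc n) * pochhammer (real (Suc m) - real (Suc n) + 1) (Suc n) *
        pochhammer (c - 1 + real (Suc n)) (Suc m - Suc n))"
    by (subst pochhammer_binomial_sum_reflected [symmetric], subst sum.atMost_Suc_shift) simp
  also have "(\<Sum>n\<le>m. real (Suc m choose Suc n) * pochhammer (real (Suc m) - real (Suc n) + 1) (Suc n) *
        pochhammer (c - 1 + real (Suc n)) (Suc m - Suc n)) =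
      (\<Sum>n\<le>m. (real m + 1)\<^sup>2 * (pochhammer c m * hyp_coeff m c n / (real n + 1)))"
    by (intro sum.cong) (use shift in auto)
  also have "\<dots> = (real m + 1)\<^sup>2 * (pochhammer c m * (\<Sum>n\<le>m. hyp_coeff m c n / (real n + 1)))"
    by (simp add: sum_distrib_left)
  also have "pochhammer (c - 1 + real (Suc m)) (Suc m) = (c + 2 * real m) * pochhammer (c + real m) m"
    by (simp add: pochhammer_rec' algebra_simps)
  also have "pochhammer (c - 1) (Suc m) = (c - 1) * pochhammer c m"
    by (simp add: pochhammer_rec)
  finally show ?thesis
    unfolding pochhammer_ratio_Gamma [OF assms, symmetric]
    using pochhammer_pos [OF assms, of m] by (simp add: field_simps)
qed

section \<open>Images starlike about the origin\<close>

text \<open>If \<open>F\<close> inverts \<open>f\<close>, the condition \<open>pos\<close> says that \<open>cmod (F (t * w))\<close> increases with \<open>t\<close>.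
  Hence the set of \<open>t\<close> with \<open>t * w\<close> in the compact set \<open>f ` cball 0 (cmod (F w))\<close> is closed and can
  be left by a decreasing \<open>t\<close> only at \<open>0\<close>.\<close>

lemma starlike_domain_image:
  assumes g: "g holomorphic_on \<D>" and g0: "g 0 = 0"
    and f: "\<And>z. f z = z + cnj (g z)"
    and inj: "inj_on f \<D>"
    and dg: "\<And>z. z \<in> \<D> \<Longrightarrow> cmod (deriv g z) < 1"
    and pos: "\<And>z. z \<in> \<D> \<Longrightarrow> z \<noteq> 0 \<Longrightarrow> Re (cnj (f z) * (z - cnj (z * deriv g z))) > 0"
  shows "starlike_domain 0 (f ` \<D>)"
proof -
  have f0: "f 0 = 0"
    by (simp add: f g0)
  have cont: "continuous_on \<D> f"
    using holomorphic_on_imp_continuous_on [OF g] unfolding f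
    by (intro continuous_intros)
  have op: "open (f ` \<D>)"
    using cont inj by (intro invariance_of_domain) auto
  define F where "F = inv_into \<D> f"
  have Ff: "F (f z) = z" if "z \<in> \<D>" for z
    using inj that by (simp add: F_def)
  have less: "\<exists>d>0. \<forall>h>0. h < d \<longrightarrow> (t - h) *\<^sub>R w \<in> f ` \<D> \<and> cmod (F ((t - h) *\<^sub>R w)) < cmod (F (t *\<^sub>R w))"
    if t: "t > 0" "w \<noteq> 0" "t *\<^sub>R w \<in> f ` \<D>" for t w
  proof -
    obtain z where z: "z \<in> \<D>" "f z = t *\<^sub>R w"
      using t by auto
    have "z \<noteq> 0"
      using z t f0 by auto
    define p where "p = deriv g z"
    \<comment> \<open>\<open>k\<close> is the Jacobian determinant of \<open>f\<close> at
      \<open>z\<close>; dividing by it makes \<open>L\<close> the inverse of the real-linear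
      derivative \<open>v + cnj (p * v)\<close>.\<close>
    define k where "k = 1 - (cmod p)\<^sup>2"
    have k: "k > 0"
      using dg [OF z(1)] by (simp add: k_def p_def power_less_one_iff abs_square_less_1)
    define L where "L = (\<lambda>y. (y - cnj p * cnj y) / of_real k)"
    have linL: "linear L"
      unfolding L_def by (rule linearI) (auto simp: algebra_simps add_divide_distrib diff_divide_distrib scaleR_conv_of_real)
    have derg: "(g has_field_derivative p) (at z)"
      using g z(1) unfolding p_def by (auto intro: holomorphic_derivI)
    have "((\<lambda>w. w + cnj (g w)) has_derivative (\<lambda>v. v + cnj (p * v))) (at z)"
      using derg unfolding has_field_derivative_def
      by (intro has_derivative_add has_derivative_cnj has_derivative_ident)
    then have derf: "(f has_derivative (\<lambda>v. v + cnj (p * v))) (at z)"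
      unfolding f [abs_def] .
    have inv: "(\<lambda>v. v + cnj (p * v)) \<circ> L = id"
    proof
      fix y
      have "cnj p * p = of_real ((cmod p)\<^sup>2)"
        by (simp only: complex_norm_square mult.commute [of p])
      then have kk: "of_real k = 1 - cnj p * p"
        by (simp add: k_def)
      have "of_real k \<noteq> (0::complex)"
        using k by simp
      then show "((\<lambda>v. v + cnj (p * v)) \<circ> L) y = id y"
        unfolding o_def L_def by (simp add: field_simps) (simp add: kk algebra_simps)
    qed
    have "(F has_derivative L) (at (f z))"
      by (rule has_derivative_inverse_strong [OF _ z(1) cont _ derf inv]) (use Ff in auto)
    then have derF: "(F has_derivative L) (at (t *\<^sub>R w))"
      by (simp add: z)
    define u where "u = (\<lambda>s. F (s *\<^sub>R w) \<bullet> F (s *\<^sub>R w))"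
    have "((\<lambda>s. F (s *\<^sub>R w)) has_derivative (\<lambda>s. L (s *\<^sub>R w))) (at t)"
      by (rule has_derivative_compose [where f = "\<lambda>s. s *\<^sub>R w" and g = F, OF _ derF]) (auto intro!: derivative_eq_intros)
    from has_derivative_inner [OF this this]
    have "(u has_derivative (\<lambda>s. s * (2 * (z \<bullet> L w)))) (at t)"
      using Ff [OF z(1)] z(2) unfolding u_def
      by (simp add: linear_cmul [OF linL] inner_commute algebra_simps)
    then have deru: "(u has_real_derivative 2 * (z \<bullet> L w)) (at t)"
      unfolding has_field_derivative_def
      by (rule has_derivative_eq_rhs) (simp add: fun_eq_iff mult_ac)
    \<comment> \<open>Here \<open>t * w\<close> is \<open>f z\<close>, and
      \<open>y - cnj p * cnj y\<close> is self-adjoint for the real inner product, so it can be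
      moved from \<open>f z\<close> onto \<open>z\<close>. This turns the derivative of the squared
      modulus into the quantity in \<open>pos\<close>.\<close>
    have "t * k * (z \<bullet> L w) = Re (cnj (f z) * (z - cnj (z * p)))"
      using k unfolding z(2) L_def
      by (simp add: inner_complex_def field_simps scaleR_conv_of_real Re_divide_of_real Im_divide_of_real)
    then have prod: "t * k * (z \<bullet> L w) > 0"
      using pos [OF z(1) \<open>z \<noteq> 0\<close>] by (simp add: p_def)
    have "2 * (z \<bullet> L w) > 0"
      using zero_less_mult_pos [OF prod mult_pos_pos [OF t(1) k]] by simp
    from DERIV_pos_inc_left [OF deru this]
    obtain d1 where d1: "d1 > 0" "\<And>h. 0 < h \<Longrightarrow> h < d1 \<Longrightarrow> u (t - h) < u t"
      by auto
    have "open ((\<lambda>s. s *\<^sub>R w) -` (f ` \<D>))"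
      by (intro open_vimage op continuous_intros)
    then obtain d2 where d2: "d2 > 0" "ball t d2 \<subseteq> (\<lambda>s. s *\<^sub>R w) -` (f ` \<D>)"
      using t(3) by (meson openE vimageI)
    show ?thesis
    proof (intro exI [of _ "min d1 d2"] conjI allI impI)
      fix h :: real
      assume h: "0 < h" "h < min d1 d2"
      then have "t - h \<in> ball t d2"
        by (simp add: dist_real_def)
      then show "(t - h) *\<^sub>R w \<in> f ` \<D>"
        using d2(2) by blast
      show "cmod (F ((t - h) *\<^sub>R w)) < cmod (F (t *\<^sub>R w))"
        using d1(2) [of h] h unfolding u_def by (simp add: dot_square_norm power_less_imp_less_base)
    qed (use d1 d2 in auto)
  qed
  have seg: "t *\<^sub>R w \<in> f ` \<D>" if w: "w \<in> f ` \<D>" and t: "0 \<le> t" "t \<le> 1" for w t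
  proof (cases "t = 0 \<or> w = 0")
    case True
    then show ?thesis
      by (metis f0 centre_in_ball image_eqI scale_zero_left scale_zero_right zero_less_one)
  next
    case False
    define r where "r = cmod (F w)"
    have r: "r < 1"
      using w Ff by (auto simp: r_def)
    then have sub: "cball 0 r \<subseteq> \<D>"
      by auto
    define K where "K = f ` cball 0 r"
    \<comment> \<open>Cutting off at \<open>t\<close> makes the claim equivalent to \<open>t\<close>
      being the infimum: a larger infimum could still be lowered by \<open>less\<close>.\<close>
    define T where "T = {t..1} \<inter> (\<lambda>s. s *\<^sub>R w) -` K"
    have "compact K"
      unfolding K_def by (intro compact_continuous_image continuous_on_subset [OF cont sub]) auto
    then have "closed T"
      unfolding T_def by (intro closed_Int closed_vimage compact_imp_closed continuous_intros) auto
    have "1 \<in> T"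
      using t w Ff unfolding T_def K_def r_def by auto
    have bdd: "bdd_below T"
      unfolding T_def by (auto intro: bdd_belowI [of _ t])
    define s where "s = Inf T"
    have "s \<in> T"
      unfolding s_def using closed_contains_Inf [OF _ bdd \<open>closed T\<close>] \<open>1 \<in> T\<close> by auto
    then obtain y where y: "y \<in> cball 0 r" "s *\<^sub>R w = f y"
      unfolding T_def K_def by auto
    have "s = t"
    proof (rule ccontr)
      assume "s \<noteq> t"
      with \<open>s \<in> T\<close> have st: "t < s" "s \<le> 1"
        by (auto simp: T_def)
      have "s *\<^sub>R w \<in> f ` \<D>"
        using y sub by auto
      from less [OF _ _ this] obtain d where d: "d > 0" and
        dd: "\<And>h. 0 < h \<Longrightarrow> h < d \<Longrightarrow> (s - h) *\<^sub>R w \<in> f ` \<D> \<and> cmod (F ((s - h) *\<^sub>R w)) < cmod (F (s *\<^sub>R w))"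
        using False st t by auto
      define h where "h = min (d / 2) (s - t)"
      have h: "0 < h" "h < d" "h \<le> s - t"
        using d st by (auto simp: h_def)
      obtain x where x: "x \<in> \<D>" "(s - h) *\<^sub>R w = f x"
        using dd [OF h(1,2)] by auto
      \<comment> \<open>The preimage has moved towards the origin, so it stays in the smaller closed
        disc and never approaches the unit circle.\<close>
      have "cmod x < cmod y"
        using dd [OF h(1,2)] y sub x Ff by (metis subsetD)
      then have "x \<in> cball 0 r"
        using y by auto
      then have "s - h \<in> T"
        using x(2) h st unfolding T_def K_def by auto
      then show False
        using cInf_lower [OF _ bdd, of "s - h"] h unfolding s_def by linarith
    qed
    then show ?thesis
      using y sub by auto
  qed
  have "closed_segment 0 w \<subseteq> f ` \<D>" if "w \<in> f ` \<D>" for w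
    using seg [OF that] by (auto simp: closed_segment_def)
  moreover have "connected (f ` \<D>)"
    by (intro connected_continuous_image cont connected_ball)
  moreover have "0 \<in> f ` \<D>"
    using f0 by (metis centre_in_ball image_eqI zero_less_one)
  ultimately show ?thesis
    using op by (simp add: starlike_domain_def)
qed

section \<open>The coefficient criterion\<close>

text \<open>\<open>b j\<close> is the coefficient of \<open>z ^ (j + 1)\<close>, so
  \<open>j + 1\<close> is the weight of differentiation. Since the sum may equal 1, strictness has
  to come from \<open>b 0\<close>: the non-injective map \<open>z + cnj z\<close> meets the sum
  condition alone.\<close>

locale coeff_bound =
  fixes b :: "nat \<Rightarrow> complex" and N :: nat
  assumes b0: "cmod (b 0) < 1"
    and sum_le: "(\<Sum>j\<le>N. (real j + 1) * cmod (b j)) \<le> 1"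
begin

definition g :: "complex \<Rightarrow> complex" where
  "g z = (\<Sum>j\<le>N. b j * z ^ (j + 1))"

definition f :: "complex \<Rightarrow> complex" where
  "f z = z + cnj (g z)"

lemma has_field_derivative_g:
  "(g has_field_derivative (\<Sum>j\<le>N. of_nat (j + 1) * b j * z ^ j)) (at z)"
proof -
  have "((\<lambda>z. b j * z ^ (j + 1)) has_field_derivative of_nat (j + 1) * b j * z ^ j) (at z)" for j
    by (rule DERIV_cong [OF DERIV_cmult [OF DERIV_power [OF DERIV_ident]]]) simp
  then show ?thesis
    unfolding g_def [abs_def] by (intro DERIV_sum)
qed

lemma deriv_g: "deriv g z = (\<Sum>j\<le>N. of_nat (j + 1) * b j * z ^ j)"
  by (intro DERIV_imp_deriv has_field_derivative_g)

lemma holomorphic_g: "g holomorphic_on A"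
  unfolding g_def [abs_def] by (intro holomorphic_intros)

text \<open>Every term with \<open>j \<ge> 1\<close> gains a factor of at most \<open>r\<close>, and
  these terms have total weight at most \<open>1 - cmod (b 0)\<close>. The bound is a convex
  combination of \<open>cmod (b 0)\<close> and 1, hence below 1 for \<open>r < 1\<close>.\<close>

lemma weighted_sum_le:
  assumes "0 \<le> r" "r \<le> 1"
  shows "(\<Sum>j\<le>N. (real j + 1) * cmod (b j) * r ^ j) \<le> cmod (b 0) + r * (1 - cmod (b 0))"
proof -
  have "(\<Sum>j\<le>N. (real j + 1) * cmod (b j) * r ^ j)
      = cmod (b 0) + (\<Sum>j=1..N. (real j + 1) * cmod (b j) * r ^ j)"
    by (simp add: sum.atLeast_Suc_atMost flip: atLeast0AtMost)
  also have "(\<Sum>j=1..N. (real j + 1) * cmod (b j) * r ^ j) \<le> (\<Sum>j=1..N. (real j + 1) * cmod (b j) * r)"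
  proof (intro sum_mono mult_left_mono)
    show "r ^ j \<le> r" if "j \<in> {1..N}" for j
      using power_decreasing [of 1 j r] assms that by simp
  qed auto
  also have "\<dots> = r * (\<Sum>j=1..N. (real j + 1) * cmod (b j))"
    by (simp add: sum_distrib_left mult_ac)
  also have "(\<Sum>j=1..N. (real j + 1) * cmod (b j)) = (\<Sum>j\<le>N. (real j + 1) * cmod (b j)) - cmod (b 0)"
    by (simp add: sum.atLeast_Suc_atMost flip: atLeast0AtMost)
  finally show ?thesis
    using mult_left_mono [OF sum_le assms(1)] by (simp add: algebra_simps)
qed

lemma weighted_sum_less_1:
  assumes "0 \<le> r" "r < 1"
  shows "(\<Sum>j\<le>N. (real j + 1) * cmod (b j) * r ^ j) < 1"
proof -
  have "r * (1 - cmod (b 0)) < 1 * (1 - cmod (b 0))"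
    using b0 assms by (intro mult_strict_right_mono) auto
  then show ?thesis
    using weighted_sum_le [of r] assms by simp
qed

lemma norm_deriv_g_le:
  "cmod (deriv g z) \<le> (\<Sum>j\<le>N. (real j + 1) * cmod (b j) * cmod z ^ j)"
  unfolding deriv_g by (rule order_trans [OF norm_sum])
    (simp add: norm_mult norm_power norm_of_nat add.commute del: of_nat_Suc of_nat_add flip: of_nat_Suc)

lemma norm_deriv_g_less_1: "z \<in> \<D> \<Longrightarrow> cmod (deriv g z) < 1"
  using norm_deriv_g_le [of z] weighted_sum_less_1 [of "cmod z"] by simp

text \<open>On a closed disc containing both points, \<open>g\<close> is Lipschitz with constant
  \<open>B < 1\<close>, whereas equal values of \<open>f\<close> force \<open>g\<close> to preserve
  their distance.\<close>

lemma inj_on_f: "inj_on f \<D>"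
proof (rule inj_onI)
  fix x y
  assume xy: "x \<in> \<D>" "y \<in> \<D>" "f x = f y"
  define r where "r = max (cmod x) (cmod y)"
  define B where "B = (\<Sum>j\<le>N. (real j + 1) * cmod (b j) * r ^ j)"
  have r: "0 \<le> r" "r < 1"
    using xy by (auto simp: r_def le_max_iff_disj)
  have "cmod (g x - g y) \<le> B * cmod (x - y)"
  proof (rule field_differentiable_bound [of "cball 0 r"])
    fix z :: complex
    assume "z \<in> cball 0 r"
    then have "(\<Sum>j\<le>N. (real j + 1) * cmod (b j) * cmod z ^ j) \<le> B"
      unfolding B_def by (intro sum_mono mult_left_mono power_mono) auto
    then show "cmod (deriv g z) \<le> B"
      using norm_deriv_g_le [of z] by linarith
    show "(g has_field_derivative deriv g z) (at z within cball 0 r)"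
      unfolding deriv_g by (intro DERIV_subset [OF has_field_derivative_g]) auto
  qed (auto simp: r_def)
  moreover have "x - y = - cnj (g x - g y)"
    using xy(3) by (simp add: f_def algebra_simps)
  then have "cmod (x - y) = cmod (g x - g y)"
    by (metis complex_mod_cnj norm_minus_cancel)
  moreover have "B < 1"
    unfolding B_def by (rule weighted_sum_less_1 [OF r])
  ultimately have "(1 - B) * cmod (x - y) \<le> 0" "1 - B > 0"
    by (auto simp: algebra_simps)
  then show "x = y"
    by (simp add: mult_le_0_iff)
qed

lemma harmonic_rep_f: "harmonic_rep f (\<lambda>z. z) g"
proof -
  have "(\<lambda>n. (if n + 1 \<le> N + 1 then b n else 0) * z ^ (n + 1)) sums g z" for z
    using sums_If_finite_set [of "{..N}" "\<lambda>n. b n * z ^ (n + 1)"]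
    by (simp add: g_def if_distrib [of "\<lambda>x. x * _"] cong: if_cong)
  \<comment> \<open>The sequence sought is indexed by the exponent of \<open>z\<close>, one more
    than the index of \<open>b\<close>; hence the witness uses \<open>b (n - 1)\<close>.\<close>
  then have "\<exists>a. \<forall>z\<in>\<D>. (\<lambda>n. a (n + 1) * z ^ (n + 1)) sums g z"
    by (intro exI [of _ "\<lambda>n. if n \<le> N + 1 then b (n - 1) else 0"]) (simp only: add_diff_cancel_right', blast)
  moreover have "\<exists>a. \<forall>z\<in>\<D>. (\<lambda>n. a (n + 2) * z ^ (n + 2)) sums (z - z)"
    by (intro exI [of _ "\<lambda>n. 0"]) simp
  ultimately show ?thesis
    unfolding harmonic_rep_def by (simp add: holomorphic_g f_def)
qed

lemma f_in_SH: "f \<in> class_SH"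
proof -
  have "\<forall>z\<in>\<D>. (cmod (deriv (\<lambda>z. z) z))\<^sup>2 - (cmod (deriv g z))\<^sup>2 > 0"
    using norm_deriv_g_less_1 by (simp add: abs_square_less_1)
  then show ?thesis
    unfolding class_SH_def using inj_on_f harmonic_rep_f by blast
qed

lemma f_in_CH1: "f \<in> class_CH1"
  unfolding class_CH1_def using f_in_SH norm_deriv_g_less_1
  by (auto simp: wirtinger_harmonic_rep [OF harmonic_rep_f])

text \<open>Two complex numbers have positive real inner product exactly when their difference is
  shorter than their sum. For \<open>z + G\<close> and \<open>z - P\<close> these are
  \<open>P + G\<close> and \<open>2 * z - (P - G)\<close>. Termwise, \<open>P + G\<close> and
  \<open>P - G\<close> carry the weights \<open>j + 2\<close> and \<open>j\<close>, which add up to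
  twice the weight \<open>j + 1\<close> of the criterion.\<close>

lemma starlike_positivity:
  assumes z: "z \<in> \<D>" "z \<noteq> 0"
  shows "Re (cnj (f z) * (z - cnj (z * deriv g z))) > 0"
proof -
  define P where "P = cnj (z * deriv g z)"
  define G where "G = cnj (g z)"
  have P: "z * deriv g z = (\<Sum>j\<le>N. of_nat (j + 1) * (b j * z ^ (j + 1)))"
    by (simp add: deriv_g sum_distrib_left algebra_simps)
  have "cmod (P + G) = cmod (\<Sum>j\<le>N. of_nat (j + 2) * (b j * z ^ (j + 1)))"
    unfolding P_def G_def P g_def complex_cnj_add [symmetric] complex_mod_cnj sum.distrib [symmetric]
    by (simp add: algebra_simps)
  also have "\<dots> \<le> (\<Sum>j\<le>N. (real j + 2) * (cmod (b j) * cmod z ^ (j + 1)))"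
    by (rule order_trans [OF norm_sum], rule sum_mono)
      (simp only: norm_mult norm_power norm_of_nat, simp add: add.commute)
  finally have 1: "cmod (P + G) \<le> (\<Sum>j\<le>N. (real j + 2) * (cmod (b j) * cmod z ^ (j + 1)))" .
  have "cmod (P - G) = cmod (\<Sum>j\<le>N. of_nat j * (b j * z ^ (j + 1)))"
    unfolding P_def G_def P g_def complex_cnj_diff [symmetric] complex_mod_cnj sum_subtractf [symmetric]
    by (simp add: algebra_simps)
  also have "\<dots> \<le> (\<Sum>j\<le>N. real j * (cmod (b j) * cmod z ^ (j + 1)))"
    by (rule order_trans [OF norm_sum], rule sum_mono)
      (simp only: norm_mult norm_power norm_of_nat)
  finally have 2: "cmod (P - G) \<le> (\<Sum>j\<le>N. real j * (cmod (b j) * cmod z ^ (j + 1)))" .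
  have "cmod (P + G) + cmod (P - G) \<le>
      2 * cmod z * (\<Sum>j\<le>N. (real j + 1) * cmod (b j) * cmod z ^ j)"
    using add_mono [OF 1 2] by (simp add: sum_distrib_left algebra_simps flip: sum.distrib)
  also have "\<dots> < 2 * cmod z * 1"
    using z weighted_sum_less_1 [of "cmod z"] by (intro mult_strict_left_mono) auto
  finally have "cmod (P + G) < 2 * cmod z - cmod (P - G)"
    by simp
  also have "\<dots> \<le> cmod (2 * z - (P - G))"
    using norm_triangle_ineq2 [of "2 * z" "P - G"] by (simp add: norm_mult)
  finally have "cmod ((z + G) - (z - P)) < cmod ((z + G) + (z - P))"
    by (simp add: algebra_simps)
  then have "(cmod ((z + G) - (z - P)))\<^sup>2 < (cmod ((z + G) + (z - P)))\<^sup>2"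
    by (intro power_strict_mono) auto
  moreover have "(cmod (x + y))\<^sup>2 - (cmod (x - y))\<^sup>2 = 4 * (x \<bullet> y)" for x y :: complex
    unfolding power2_norm_eq_inner by (simp add: inner_simps inner_commute)
  ultimately have "0 < 4 * ((z + G) \<bullet> (z - P))"
    by (metis diff_gt_0_iff_gt)
  then show ?thesis
    unfolding f_def P_def G_def by (simp add: inner_complex_def algebra_simps)
qed

lemma f_in_SH_star0:
  assumes "b 0 = 0"
  shows "f \<in> class_SH_star0"
proof -
  have "deriv g 0 = 0"
    using assms by (simp add: deriv_g power_0_left if_distrib cong: if_cong)
  then have "wirtinger_zbar f 0 = 0"
    by (simp add: wirtinger_harmonic_rep [OF harmonic_rep_f])
  moreover have "starlike_domain 0 (f ` \<D>)"
    by (rule starlike_domain_image [OF holomorphic_g _ f_def inj_on_f])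
      (simp add: g_def, fact norm_deriv_g_less_1, fact starlike_positivity)
  ultimately show ?thesis
    using f_in_SH by (simp add: class_SH_star0_def)
qed

end

section \<open>The hypergeometric maps as instances of the criterion\<close>

lemma sum_atMost_add_shift:
  fixes \<phi> :: "nat \<Rightarrow> 'a::comm_monoid_add"
  shows "(\<Sum>j\<le>m + k. if j < k then 0 else \<phi> (j - k)) = (\<Sum>n\<le>m. \<phi> n)"
proof (induction k)
  case (Suc k)
  have "(\<Sum>j\<le>m + Suc k. if j < Suc k then 0 else \<phi> (j - Suc k)) =
      (\<Sum>j\<le>m + k. if j < k then 0 else \<phi> (j - k))"
    unfolding add_Suc_right by (subst sum.atMost_Suc_shift) (simp cong: if_cong)
  with Suc show ?case
    by simp
qed simp

text \<open>The factor \<open>z ^ k\<close> moves the coefficients up by \<open>k\<close> places;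
  for \<open>k = 1\<close> the zero put in front gives the normalisation of the zbar-derivative at
  0.\<close>

definition hyp_map_coeff :: "nat \<Rightarrow> real \<Rightarrow> complex \<Rightarrow> nat \<Rightarrow> nat \<Rightarrow> complex" where
  "hyp_map_coeff m c \<alpha> k j =
     (if j < k then 0 else \<alpha> * of_real (hyp_coeff m c (j - k) / (real (j - k) + 1)))"

lemma hyp_map_eq:
  "hyp_map m c \<alpha> k z = z + cnj (\<Sum>j\<le>m + k. hyp_map_coeff m c \<alpha> k j * z ^ (j + 1))"
proof -
  have "(\<Sum>j\<le>m + k. hyp_map_coeff m c \<alpha> k j * z ^ (j + 1)) =
      (\<Sum>j\<le>m + k. if j < k then 0 else
         (\<lambda>n. \<alpha> * of_real (hyp_coeff m c n / (real n + 1)) * z ^ (n + k + 1)) (j - k))"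
    by (intro sum.cong) (auto simp: hyp_map_coeff_def)
  also have "\<dots> = (\<Sum>n\<le>m. \<alpha> * of_real (hyp_coeff m c n / (real n + 1)) * z ^ (n + k + 1))"
    by (rule sum_atMost_add_shift)
  also have "\<dots> = \<alpha> * z ^ k * (\<Sum>n=0..m. of_real (hyp_coeff m c n) * (z ^ (n + 1) / of_nat (n + 1)))"
    by (simp add: sum_distrib_left atLeast0AtMost power_add mult_ac add.commute)
  finally show ?thesis
    by (simp add: hyp_map_def hyp_coeff_def)
qed

text \<open>At \<open>j = n + k\<close> the weight over the divisor is
  \<open>(n + k + 1) / (n + 1) = 1 + k / (n + 1)\<close>, which separates the two sums evaluated
  above.\<close>

lemma sum_norm_hyp_map_coeff:
  assumes "c > 0"
  shows "(\<Sum>j\<le>m + k. (real j + 1) * cmod (hyp_map_coeff m c \<alpha> k j)) =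
    cmod \<alpha> * ((\<Sum>n\<le>m. hyp_coeff m c n) + real k * (\<Sum>n\<le>m. hyp_coeff m c n / (real n + 1)))"
proof -
  have "(\<Sum>j\<le>m + k. (real j + 1) * cmod (hyp_map_coeff m c \<alpha> k j)) =
      (\<Sum>j\<le>m + k. if j < k then 0 else
         (\<lambda>n. (real (n + k) + 1) * (cmod \<alpha> * (hyp_coeff m c n / (real n + 1)))) (j - k))"
    using hyp_coeff_nonneg [OF assms]
    by (intro sum.cong) (auto simp: hyp_map_coeff_def norm_mult simp del: of_real_divide)
  also have "\<dots> = (\<Sum>n\<le>m. (real (n + k) + 1) * (cmod \<alpha> * (hyp_coeff m c n / (real n + 1))))"
    by (rule sum_atMost_add_shift)
  also have "\<dots> = (\<Sum>n\<le>m. cmod \<alpha> * (hyp_coeff m c n + real k * (hyp_coeff m c n / (real n + 1))))"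
    by (intro sum.cong) (auto simp: field_simps)
  finally show ?thesis
    by (simp add: sum_distrib_left sum.distrib algebra_simps)
qed

theorem corollary5:
  fixes m :: nat and c :: real and \<alpha> :: complex
  assumes "m > 0" and "c > 0"
  shows "(0 < cmod \<alpha> \<and> cmod \<alpha> < 1 \<and>
          Gamma c * Gamma (c + 2 * real m) / (Gamma (c + real m))\<^sup>2 \<le> 1 / cmod \<alpha>
            \<longrightarrow> hyp_map m c \<alpha> 0 \<in> class_CH1)
       \<and> (0 < cmod \<alpha> \<and> cmod \<alpha> < 1 / 2 \<and>
          cmod \<alpha> * (Gamma c * Gamma (c + 2 * real m) / (Gamma (c + real m))\<^sup>2)
              * (1 + (c + 2 * real m) / (real m + 1)\<^sup>2)
            \<le> 1 + cmod \<alpha> * (c - 1) / (real m + 1)\<^sup>2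
            \<longrightarrow> hyp_map m c \<alpha> 1 \<in> class_CH1 \<inter> class_SH_star0)"
proof -
  define Q where "Q = Gamma c * Gamma (c + 2 * real m) / (Gamma (c + real m))\<^sup>2"
  note S1 = sum_hyp_coeff [OF assms(2), of m, folded Q_def]
  have S2: "(\<Sum>n\<le>m. hyp_coeff m c n / (real n + 1)) =
      ((c + 2 * real m) * Q - (c - 1)) / (real m + 1)\<^sup>2"
    using sum_hyp_coeff_divide [OF assms(2), of m, folded Q_def]
    by (simp add: eq_divide_eq mult.commute)
  have "hyp_map m c \<alpha> 0 \<in> class_CH1"
    if \<alpha>: "0 < cmod \<alpha>" "cmod \<alpha> < 1" and "Q \<le> 1 / cmod \<alpha>"
  proof -
    have "cmod \<alpha> * Q \<le> 1"
      using that by (simp add: field_simps)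
    \<comment> \<open>Since \<open>hyp_coeff m c 0\<close> is 1, the lowest coefficient is
      \<open>\<alpha>\<close> itself, and \<open>cmod \<alpha> < 1\<close> supplies the strict
      condition.\<close>
    then interpret coeff_bound "hyp_map_coeff m c \<alpha> 0" m
      using \<alpha> sum_norm_hyp_map_coeff [OF assms(2), where m = m and k = 0 and \<alpha> = \<alpha>]
      by unfold_locales (simp_all only: S1, simp_all add: hyp_map_coeff_def hyp_coeff_def)
    have "hyp_map m c \<alpha> 0 = f"
      by (rule ext) (simp only: hyp_map_eq f_def g_def add_0_right)
    then show ?thesis
      using f_in_CH1 by simp
  qed
  moreover have "hyp_map m c \<alpha> 1 \<in> class_CH1 \<inter> class_SH_star0"
    if "cmod \<alpha> * Q * (1 + (c + 2 * real m) / (real m + 1)\<^sup>2)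
            \<le> 1 + cmod \<alpha> * (c - 1) / (real m + 1)\<^sup>2"
  proof -
    \<comment> \<open>By \<open>S1\<close> and \<open>S2\<close> the left-hand side is the weighted
      coefficient sum for \<open>k = 1\<close>; moving the \<open>c - 1\<close> term across recovers
      the hypothesis.\<close>
    have "cmod \<alpha> * (Q + ((c + 2 * real m) * Q - (c - 1)) / (real m + 1)\<^sup>2) \<le> 1"
      using that by (simp add: algebra_simps diff_divide_distrib add_divide_distrib)
    moreover have zero: "hyp_map_coeff m c \<alpha> 1 0 = 0"
      by (simp add: hyp_map_coeff_def)
    ultimately interpret coeff_bound "hyp_map_coeff m c \<alpha> 1" "m + 1"
      using sum_norm_hyp_map_coeff [OF assms(2), where m = m and k = 1 and \<alpha> = \<alpha>]
      by unfold_locales (simp_all add: S1 S2)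
    have "hyp_map m c \<alpha> 1 = f"
      by (rule ext) (simp only: hyp_map_eq f_def g_def add_0_right)
    then show ?thesis
      using f_in_CH1 f_in_SH_star0 [OF zero] by simp
  qed
  ultimately show ?thesis
    unfolding Q_def by blast
qed

end
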